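(* Let $G$ be a connected graph with bounded degree, either oriented (each edge is given one fixed orientation) or unoriented, with a fixed origin $o\in V(G)$, and suppose that $p_c^{\mathrm s}(G)<1$. Then $$p_c^{\mathrm s}(G\times\mathbb{Z}_+)<p_c^{\mathrm s}(G),$$ where $G\times\mathbb{Z}_+$ is the ladder graph of $G$, with origin $(o,0)$.
   Context: $\mathbb{Z}_+=\{0,1,2,\dots\}$. Connectedness and degree of an oriented graph refer to the underlying unoriented graph. Ladder graph: $G\times\mathbb{Z}_+$ has vertex set $V(G)\times\mathbb{Z}_+$ and two types of edges: horizontal edges from $(v,n)$ to $(u,n)$ for each edge $vu\in E(G)$ and $n\in\mathbb{Z}_+$, with the same orientation as $vu$ if $G$ is oriented and unoriented if $G$ is unoriented; and vertical edges from $(v,n)$ to $(v,n+1)$ for $v\in V(G)$, $n\in\mathbb{Z}_+$, always oriented upwards. Bernoulli site percolation with parameter $p\in[0,1]$ on a graph: every vertex is independently open with probability $p$ and closed with probability $1-p$; $\mathbb{P}_p$ denotes the law. For a vertex $v_0$, $\{v_0\to\infty\}$ is the event that there is an infinite sequence of distinct open vertices $v_0,v_1,v_2,\dots$ such that each $\langle v_{n-1},v_n\rangle$, $n\ge1$, is an edge of the graph (oriented edges are traversed only in the direction of their orientation, unoriented edges in either direction). For a graph $G$ with fixed origin $o$, $p_c^{\mathrm s}(G)=\inf\{p:\ \mathbb{P}_p(o\to\infty)>0\}$. *)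

theory Defs
  imports "HOL-Probability.Probability"
begin

text \<open>
  Simple graphs, possibly infinite, whose edges may be unoriented (two-element sets) or oriented
  (ordered pairs). A graph as such is purely unoriented or purely oriented; both kinds of edges
  occur together only in the ladder of an unoriented graph.
\<close>

record 'a mixed_graph =
  verts :: "'a set"
  uedges :: "'a set set"
  oedges :: "('a \<times> 'a) set"

definition unoriented_graph :: "'a mixed_graph \<Rightarrow> bool" where
  "unoriented_graph G \<longleftrightarrow>
     (\<forall>e\<in>uedges G. e \<subseteq> verts G \<and> card e = 2) \<and> oedges G = {}"

text \<open>Asymmetry excludes loops, and says that every edge carries only one orientation.\<close>

definition oriented_graph :: "'a mixed_graph \<Rightarrow> bool" where
  "oriented_graph G \<longleftrightarrow>
     uedges G = {} \<and> oedges G \<subseteq> verts G \<times> verts G \<and> asym (oedges G)"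

definition underlying_edges :: "'a mixed_graph \<Rightarrow> 'a set set" where
  "underlying_edges G = uedges G \<union> {{u, v} | u v. (u, v) \<in> oedges G}"

definition connected_graph :: "'a mixed_graph \<Rightarrow> bool" where
  "connected_graph G \<longleftrightarrow>
     (\<forall>u\<in>verts G. \<forall>v\<in>verts G. (u, v) \<in> {(x, y). {x, y} \<in> underlying_edges G}\<^sup>*)"

text \<open>Finiteness is required separately, since \<open>card\<close> of an infinite set is 0.\<close>

definition bounded_degree :: "'a mixed_graph \<Rightarrow> bool" where
  "bounded_degree G \<longleftrightarrow>
     (\<exists>D::nat. \<forall>v\<in>verts G. finite {e \<in> underlying_edges G. v \<in> e} \<and>
                          card {e \<in> underlying_edges G. v \<in> e} \<le> D)"

definition ladder :: "'a mixed_graph \<Rightarrow> ('a \<times> nat) mixed_graph" where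
  "ladder G =
     \<lparr> verts = verts G \<times> UNIV,
       uedges = {{(v, n), (u, n)} | v u n. {v, u} \<in> uedges G},
       oedges = {((v, n), (u, n)) | v u n. (v, u) \<in> oedges G} \<union>
                {((v, n), (v, Suc n)) | v n. v \<in> verts G} \<rparr>"

definition traversable :: "'a mixed_graph \<Rightarrow> 'a \<Rightarrow> 'a \<Rightarrow> bool" where
  "traversable G u v \<longleftrightarrow> {u, v} \<in> uedges G \<or> (u, v) \<in> oedges G"

text \<open>In a configuration \<open>\<omega>\<close>, the vertex \<open>v\<close> is open iff \<open>\<omega> v\<close> holds.\<close>

definition reaches_infinity :: "'a mixed_graph \<Rightarrow> ('a \<Rightarrow> bool) \<Rightarrow> 'a \<Rightarrow> bool" where
  "reaches_infinity G \<omega> v0 \<longleftrightarrow>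
     (\<exists>x :: nat \<Rightarrow> 'a. x 0 = v0 \<and> inj x \<and>
        (\<forall>n. x n \<in> verts G \<and> \<omega> (x n)) \<and> (\<forall>n. traversable G (x n) (x (Suc n))))"

definition site_percolation :: "'a mixed_graph \<Rightarrow> real \<Rightarrow> ('a \<Rightarrow> bool) measure" where
  "site_percolation G p = (\<Pi>\<^sub>M v\<in>verts G. measure_pmf (bernoulli_pmf p))"

text \<open>
  In a locally finite graph the event below is measurable: by Koenig's lemma it holds iff there
  are self-avoiding open paths of every finite length starting at \<open>v0\<close>.
\<close>

definition percolation_prob :: "'a mixed_graph \<Rightarrow> 'a \<Rightarrow> real \<Rightarrow> real" where
  "percolation_prob G v0 p =
     measure (site_percolation G p)
       {\<omega> \<in> space (site_percolation G p). reaches_infinity G \<omega> v0}"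

text \<open>
  The infimum is taken in the interval from 0 to 1, so that the infimum of the empty set is 1;
  inserting 1 has no other effect.
\<close>

definition site_pc :: "'a mixed_graph \<Rightarrow> 'a \<Rightarrow> real" where
  "site_pc G v0 = Inf (insert 1 {p. 0 \<le> p \<and> p \<le> 1 \<and> percolation_prob G v0 p > 0})"

end

theory Submission
  imports Defs
begin

text \<open>
  Explore the cluster of the origin in \<open>G\<close> from one reached vertex at a time, and follow it in the
  ladder, where a vertex \<open>v\<close> is reached at some height \<open>n\<close>. An out-neighbour \<open>u\<close> seen for the first
  time is tried at \<open>(u, n)\<close>, and if this fails, via \<open>(v, n + 1)\<close> at \<open>(u, n + 1)\<close>. All vertices examined
  on the way are new, so each step is independent of the past. With probability at least
  \<open>p ^ (D + 1)\<close>, where \<open>D\<close> bounds the degree, the second chance lets all new neighbours succeed;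
  this is more than what raising \<open>p\<close> to \<open>p + \<epsilon>\<close> in \<open>G\<close> contributes in one step, if \<open>\<epsilon>\<close> is small
  depending on \<open>p\<close> and \<open>D\<close>. Hence percolation on \<open>G\<close> at \<open>p + \<epsilon>\<close> forces percolation on the ladder
  at \<open>p\<close>, and one takes \<open>p < p\<^sub>c < p + \<epsilon>\<close>; here \<open>p\<^sub>c > 0\<close> since the degree is bounded.
\<close>

section \<open>Bernoulli product measures\<close>

text \<open>Points of the product space over \<open>K\<close> are \<open>undefined\<close> off
  \<open>K\<close>, while \<omega> is a total function; the first conjunct reconciles the two.
  Measurability refers to discrete factors, so the notion does not depend on the parameter of the
  percolation.\<close>

definition determined :: "'b set \<Rightarrow> (('b \<Rightarrow> bool) \<Rightarrow> bool) \<Rightarrow> bool" where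
  "determined K Q \<longleftrightarrow> (\<forall>\<omega>. Q (restrict \<omega> K) = Q \<omega>) \<and>
     Q \<in> measurable (\<Pi>\<^sub>M i\<in>K. count_space UNIV) (count_space UNIV)"

lemma determined_cong:
  assumes "determined K Q" "\<And>i. i \<in> K \<Longrightarrow> \<omega> i = \<omega>' i"
  shows "Q \<omega> = Q \<omega>'"
proof -
  have "restrict \<omega> K = restrict \<omega>' K"
    using assms(2) by (rule restrict_ext)
  then have "Q (restrict \<omega> K) = Q (restrict \<omega>' K)" by simp
  then show ?thesis using assms(1) by (simp add: determined_def)
qed

lemma determined_mono:
  assumes "determined K Q" "K \<subseteq> K'"
  shows "determined K' Q"
proof -
  have "(\<lambda>\<omega>. Q (restrict \<omega> K)) \<in> measurable (\<Pi>\<^sub>M i\<in>K'. count_space UNIV) (count_space UNIV)"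
    using measurable_compose[OF measurable_restrict_subset[OF assms(2)]] assms(1)
    unfolding determined_def by blast
  then have "Q \<in> measurable (\<Pi>\<^sub>M i\<in>K'. count_space UNIV) (count_space UNIV)"
    using assms(1) by (simp add: determined_def)
  moreover have "Q (restrict \<omega> K') = Q \<omega>" for \<omega>
    using assms by (intro determined_cong[OF assms(1)]) auto
  ultimately show ?thesis by (simp add: determined_def)
qed

lemma determined_const: "determined K (\<lambda>\<omega>. c)"
  by (simp add: determined_def)

lemma determined_coord: "i \<in> K \<Longrightarrow> determined K (\<lambda>\<omega>. \<omega> i)"
  by (auto simp: determined_def)

lemma determined_not: "determined K Q \<Longrightarrow> determined K (\<lambda>\<omega>. \<not> Q \<omega>)"
  by (auto simp: determined_def)

lemma determined_conj: "determined K P \<Longrightarrow> determined K Q \<Longrightarrow> determined K (\<lambda>\<omega>. P \<omega> \<and> Q \<omega>)"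
  by (auto simp: determined_def)

lemma determined_disj: "determined K P \<Longrightarrow> determined K Q \<Longrightarrow> determined K (\<lambda>\<omega>. P \<omega> \<or> Q \<omega>)"
  by (auto simp: determined_def)

lemma determined_ball:
  "countable X \<Longrightarrow> (\<And>x. x \<in> X \<Longrightarrow> determined K (Q x)) \<Longrightarrow> determined K (\<lambda>\<omega>. \<forall>x\<in>X. Q x \<omega>)"
  unfolding determined_def pred_def
  by (auto intro!: sets.sets_Collect_countable_All')

lemma determined_bex:
  "countable X \<Longrightarrow> (\<And>x. x \<in> X \<Longrightarrow> determined K (Q x)) \<Longrightarrow> determined K (\<lambda>\<omega>. \<exists>x\<in>X. Q x \<omega>)"
  unfolding determined_def pred_def
  by (auto intro!: sets.sets_Collect_countable_Ex')

lemmas determined_intros = determined_const determined_coord determined_not determined_conj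
  determined_disj determined_ball determined_bex

abbreviation bern :: "'b set \<Rightarrow> real \<Rightarrow> ('b \<Rightarrow> bool) measure" where
  "bern I p \<equiv> \<Pi>\<^sub>M i\<in>I. measure_pmf (bernoulli_pmf p)"

definition Pr :: "'b set \<Rightarrow> real \<Rightarrow> (('b \<Rightarrow> bool) \<Rightarrow> bool) \<Rightarrow> real" where
  "Pr I p Q = measure (bern I p) {\<omega> \<in> space (bern I p). Q \<omega>}"

lemma sets_bern: "sets (bern I p) = sets (\<Pi>\<^sub>M i\<in>I. count_space UNIV)"
  by (intro sets_PiM_cong) auto

lemma determined_sets: "determined I Q \<Longrightarrow> {\<omega> \<in> space (bern I p). Q \<omega>} \<in> sets (bern I p)"
  by (simp add: determined_def pred_def[symmetric] measurable_cong_sets[OF sets_bern refl])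

interpretation bern: product_prob_space "\<lambda>i. measure_pmf (bernoulli_pmf p)" I for I :: "'b set" and p
  by unfold_locales

lemma Pr_mono: "determined I Q \<Longrightarrow> (\<And>\<omega>. P \<omega> \<Longrightarrow> Q \<omega>) \<Longrightarrow> Pr I p P \<le> Pr I p Q"
  unfolding Pr_def by (intro bern.P.finite_measure_mono determined_sets) auto

lemma Pr_nonneg: "0 \<le> Pr I p Q"
  by (simp add: Pr_def)

lemma Pr_le_1: "Pr I p Q \<le> 1"
  by (simp add: Pr_def)

lemma Pr_True: "Pr I p (\<lambda>\<omega>. True) = 1"
  by (simp add: Pr_def bern.P.prob_space)

lemma Pr_False: "Pr I p (\<lambda>\<omega>. False) = 0"
  by (simp add: Pr_def)

lemma Pr_not: "determined I Q \<Longrightarrow> Pr I p (\<lambda>\<omega>. \<not> Q \<omega>) = 1 - Pr I p Q"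
  unfolding Pr_def using bern.P.prob_neg[OF determined_sets] by blast

lemma Pr_bex:
  assumes "finite X" "\<And>x. x \<in> X \<Longrightarrow> determined I (Q x)"
  shows "Pr I p (\<lambda>\<omega>. \<exists>x\<in>X. Q x \<omega>) \<le> (\<Sum>x\<in>X. Pr I p (Q x))"
proof -
  have "{\<omega> \<in> space (bern I p). \<exists>x\<in>X. Q x \<omega>} = (\<Union>x\<in>X. {\<omega> \<in> space (bern I p). Q x \<omega>})"
    by auto
  then show ?thesis unfolding Pr_def
    using assms by (simp add: image_subset_iff determined_sets bern.P.finite_measure_subadditive_finite)
qed

lemma Pr_bex_disjoint:
  assumes "finite X" "\<And>x. x \<in> X \<Longrightarrow> determined I (Q x)"
    and "\<And>x y \<omega>. Q x \<omega> \<Longrightarrow> Q y \<omega> \<Longrightarrow> x = y"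
  shows "Pr I p (\<lambda>\<omega>. \<exists>x\<in>X. Q x \<omega>) = (\<Sum>x\<in>X. Pr I p (Q x))"
proof -
  have "{\<omega> \<in> space (bern I p). \<exists>x\<in>X. Q x \<omega>} = (\<Union>x\<in>X. {\<omega> \<in> space (bern I p). Q x \<omega>})"
    by auto
  moreover have "disjoint_family_on (\<lambda>x. {\<omega> \<in> space (bern I p). Q x \<omega>}) X"
    using assms(3) by (auto simp: disjoint_family_on_def)
  ultimately show ?thesis unfolding Pr_def
    using assms(1,2) by (simp add: image_subset_iff determined_sets bern.P.finite_measure_finite_Union)
qed

lemma Pr_ball:
  assumes "finite J" "J \<subseteq> I" "0 \<le> p" "p \<le> 1"
  shows "Pr I p (\<lambda>\<omega>. \<forall>j\<in>J. \<omega> j = b j) = (\<Prod>j\<in>J. if b j then p else 1 - p)"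
proof -
  have "{\<omega> \<in> space (bern I p). \<forall>j\<in>J. \<omega> j = b j} =
        prod_emb I (\<lambda>i. measure_pmf (bernoulli_pmf p)) J (Pi\<^sub>E J (\<lambda>j. {b j}))"
    using assms(2) by (auto simp: prod_emb_def space_PiM PiE_iff extensional_def)
  then show ?thesis unfolding Pr_def
    using assms by (simp add: bern.measure_PiM_emb measure_pmf_single) (auto intro!: prod.cong)
qed

text \<open>The coordinates are independent under the product measure, hence so are the restrictions
  to disjoint blocks of coordinates.\<close>

lemma Pr_conj_indep:
  assumes P: "determined J P" and Q: "determined (I - J) Q" and J: "J \<subseteq> I"
  shows "Pr I p (\<lambda>\<omega>. P \<omega> \<and> Q \<omega>) = Pr I p P * Pr I p Q"
\<comment> \<open>Independence is read off below from the joint law over a nonempty index set; over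
  an empty one both events are constant.\<close>
proof (cases "I = {}")
  case True
  have "P = (\<lambda>\<omega>. P undefined)"
    using J True by (intro ext determined_cong[OF P]) auto
  moreover have "Q = (\<lambda>\<omega>. Q undefined)"
    using True by (intro ext determined_cong[OF Q]) auto
  ultimately obtain a b where "P = (\<lambda>\<omega>. a)" "Q = (\<lambda>\<omega>. b)" by blast
  then show ?thesis
    using Pr_True[of I p] Pr_False[of I p] by (cases a; cases b) simp_all
next
  case False
  let ?M = "bern I p" and ?m = "\<lambda>i::'b. measure_pmf (bernoulli_pmf p)"
  have "bern.P.indep_vars I p ?m (\<lambda>i \<omega>. \<omega> i) I"
  proof (subst bern.P.indep_vars_iff_distr_eq_PiM'[OF False])
    \<comment> \<open>Restriction to \<open>I\<close> is the identity on the space, so the joint law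
      of the coordinates is the product measure itself.\<close>
    have "distr ?M ?M (\<lambda>x. \<lambda>i\<in>I. x i) = distr ?M ?M (\<lambda>x. x)"
      by (intro distr_cong) (auto simp: space_PiM PiE_def extensional_restrict)
    also have "\<dots> = ?M" by simp
    also have "\<dots> = (\<Pi>\<^sub>M i\<in>I. distr ?M (?m i) (\<lambda>x. x i))"
      by (intro PiM_cong refl bern.PiM_component[symmetric])
    finally show "distr ?M ?M (\<lambda>x. \<lambda>i\<in>I. x i) = (\<Pi>\<^sub>M i\<in>I. distr ?M (?m i) (\<lambda>x. x i))" .
  qed auto
  then have "bern.P.indep_var I p (PiM J ?m) (\<lambda>\<omega>. restrict \<omega> J) (PiM (I - J) ?m) (\<lambda>\<omega>. restrict \<omega> (I - J))"
    using bern.P.indep_var_restrict[where X="\<lambda>i \<omega>. \<omega> i" and A=J and B="I - J"] J by auto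
  from bern.P.indep_varD[OF this determined_sets[OF P] determined_sets[OF Q]]
  have "Pr I p (\<lambda>\<omega>. P (restrict \<omega> J) \<and> Q (restrict \<omega> (I - J))) =
        Pr I p (\<lambda>\<omega>. P (restrict \<omega> J)) * Pr I p (\<lambda>\<omega>. Q (restrict \<omega> (I - J)))"
    unfolding Pr_def by (simp add: vimage_def space_PiM PiE_iff conj_commute Int_def)
  then show ?thesis using P Q by (simp add: determined_def)
qed

lemma Pr_if:
  assumes b: "determined J b" and X: "determined (I - J) X" and Y: "determined (I - J) Y" and J: "J \<subseteq> I"
  shows "Pr I p (\<lambda>\<omega>. if b \<omega> then X \<omega> else Y \<omega>) = Pr I p b * Pr I p X + (1 - Pr I p b) * Pr I p Y"
proof -
  \<comment> \<open>A disjoint union over the truth value \<open>c\<close> of \<open>b\<close>; on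
    each part \<open>b\<close> is independent of the branch taken.\<close>
  let ?Q = "\<lambda>c \<omega>. if c then b \<omega> \<and> X \<omega> else \<not> b \<omega> \<and> Y \<omega>"
  have bI: "determined I b" and XI: "determined I X" and YI: "determined I Y"
    by (rule determined_mono[OF b J] determined_mono[OF X Diff_subset] determined_mono[OF Y Diff_subset])+
  have "Pr I p (\<lambda>\<omega>. if b \<omega> then X \<omega> else Y \<omega>) = Pr I p (\<lambda>\<omega>. \<exists>c\<in>UNIV. ?Q c \<omega>)"
    by (intro arg_cong[where f="Pr I p"] ext) (simp add: ex_bool_eq)
  also have "\<dots> = (\<Sum>c\<in>UNIV. Pr I p (?Q c))"
  proof (rule Pr_bex_disjoint)
    fix c show "determined I (?Q c)"
      by (cases c) (simp_all add: determined_conj determined_not bI XI YI)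
  qed (simp_all split: if_splits)
  also have "\<dots> = Pr I p (\<lambda>\<omega>. b \<omega> \<and> X \<omega>) + Pr I p (\<lambda>\<omega>. \<not> b \<omega> \<and> Y \<omega>)"
    by (simp add: UNIV_bool)
  also have "\<dots> = Pr I p b * Pr I p X + Pr I p (\<lambda>\<omega>. \<not> b \<omega>) * Pr I p Y"
    using Pr_conj_indep[OF b X J] Pr_conj_indep[OF determined_not[OF b] Y J] by simp
  finally show ?thesis by (simp add: Pr_not[OF bI])
qed

section \<open>Random subsets\<close>

text \<open>The expectation of \<open>f\<close> at a random subset of \<open>U\<close> that contains
  each element independently with probability \<open>p\<close>.\<close>

definition subset_avg :: "real \<Rightarrow> 'u set \<Rightarrow> ('u set \<Rightarrow> real) \<Rightarrow> real" where
  "subset_avg p U f = (\<Sum>B\<in>Pow U. (\<Prod>x\<in>U. if x \<in> B then p else 1 - p) * f B)"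

lemma subset_avg_empty: "subset_avg p {} f = f {}"
  by (simp add: subset_avg_def)

lemma subset_avg_insert:
  assumes "finite U" "u \<notin> U"
  shows "subset_avg p (insert u U) f = (1 - p) * subset_avg p U f + p * subset_avg p U (\<lambda>B. f (insert u B))"
proof -
  have inj: "inj_on (insert u) (Pow U)" and dis: "Pow U \<inter> insert u ` Pow U = {}"
    using assms(2) by (auto simp: inj_on_def)
  have out: "(\<Prod>x\<in>insert u U. if x \<in> B then p else 1 - p) = (1 - p) * (\<Prod>x\<in>U. if x \<in> B then p else 1 - p)"
    if "B \<in> Pow U" for B
    using assms that by auto
  have ins: "(\<Prod>x\<in>insert u U. if x \<in> insert u B then p else 1 - p) = p * (\<Prod>x\<in>U. if x \<in> B then p else 1 - p)"
    for B
    using assms by (auto intro!: prod.cong arg_cong[where f="(*) p"])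
  have fin: "finite (Pow U)"
    using assms(1) by simp
  show ?thesis
    unfolding subset_avg_def Pow_insert sum.union_disjoint[OF fin finite_imageI[OF fin] dis]
      sum.reindex[OF inj] o_def ins sum_distrib_left
    by (intro arg_cong2[where f="(+)"] sum.cong refl) (simp_all add: out mult.assoc)
qed

lemma subset_avg_affine:
  "finite U \<Longrightarrow> subset_avg p U (\<lambda>B. a * f B + b) = a * subset_avg p U f + b"
  by (induction U arbitrary: f rule: finite_induct)
    (simp_all add: subset_avg_empty subset_avg_insert algebra_simps)

lemma subset_avg_mono:
  assumes "0 \<le> p" "p \<le> 1" "\<And>B. B \<subseteq> U \<Longrightarrow> f B \<le> g B"
  shows "subset_avg p U f \<le> subset_avg p U g"
  unfolding subset_avg_def using assms by (intro sum_mono mult_left_mono prod_nonneg) auto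

text \<open>
  A \<open>q\<close>-random set is the union of a \<open>p\<close>-random and a \<open>d\<close>-random one, if \<open>1 - q = (1 - p) * (1 - d)\<close>.
  The second one is replaced by the whole set as soon as it is nonempty.
\<close>

lemma subset_avg_sprinkle:
  assumes "finite U" and q: "1 - q = (1 - p) * (1 - d)" "0 \<le> q" "q \<le> 1"
    and p: "0 \<le> p" "p \<le> 1" and d: "0 \<le> d" "d \<le> 1"
    and "\<And>B C. B \<subseteq> C \<Longrightarrow> C \<subseteq> U \<Longrightarrow> f B \<le> f C"
  shows "subset_avg q U f \<le> (1 - d) ^ card U * subset_avg p U f + (1 - (1 - d) ^ card U) * f U"
  using assms(1,9)
proof (induction U arbitrary: f rule: finite_induct)
  case empty
  then show ?case by (simp add: subset_avg_empty)
next
  case (insert u U)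
  define k where "k = (1 - d) ^ card U"
  define f1 where "f1 = (\<lambda>B. f (Set.insert u B))"
  have k: "0 \<le> k" "k \<le> 1"
    using d by (auto simp: k_def power_le_one)
  have f0: "subset_avg q U f \<le> k * subset_avg p U f + (1 - k) * f U"
    unfolding k_def by (rule insert.IH, rule insert.prems) auto
  have f1: "subset_avg q U f1 \<le> k * subset_avg p U f1 + (1 - k) * f1 U"
    unfolding k_def f1_def by (rule insert.IH, rule insert.prems) auto
  have fU: "f U \<le> f1 U"
    unfolding f1_def by (rule insert.prems) auto
  have "subset_avg q U f1 \<le> subset_avg q U (\<lambda>B. f1 U)"
    using q by (intro subset_avg_mono) (auto simp: f1_def intro!: insert.prems)
  then have f1': "subset_avg q U f1 \<le> f1 U"
    using subset_avg_affine[OF insert.hyps(1), of q 0 _ "f1 U"] by simp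
  have *: "(1 - k) * f U \<le> (1 - k) * f1 U"
    using fU k by (intro mult_left_mono) auto
  have f0': "subset_avg q U f \<le> k * subset_avg p U f + (1 - k) * f1 U"
    using f0 * by linarith
  have q': "q = 1 - (1 - p) * (1 - d)"
    using q(1) by linarith
  \<comment> \<open>The case that the sprinkled set contains \<open>u\<close> is separated with
    weight \<open>d\<close>. There \<open>f1 U\<close> is a sufficient bound; in the other case
    \<open>u\<close> is present with probability \<open>p\<close> and the induction hypotheses
    apply.\<close>
  have split: "(1 - q) * x + q * y = (1 - d) * ((1 - p) * x + p * y) + d * y" for x y
    unfolding q' by (simp add: algebra_simps)
  have "subset_avg q (insert u U) f = (1 - q) * subset_avg q U f + q * subset_avg q U f1"
    by (simp add: subset_avg_insert insert.hyps f1_def[symmetric])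
  also have "\<dots> = (1 - d) * ((1 - p) * subset_avg q U f + p * subset_avg q U f1) + d * subset_avg q U f1"
    by (rule split)
  also have "\<dots> \<le> (1 - d) * ((1 - p) * (k * subset_avg p U f + (1 - k) * f1 U) +
      p * (k * subset_avg p U f1 + (1 - k) * f1 U)) + d * f1 U"
    using p d f0' f1 f1' by (intro add_mono mult_left_mono) auto
  also have "\<dots> = ((1 - d) * k) * ((1 - p) * subset_avg p U f + p * subset_avg p U f1) +
      (1 - (1 - d) * k) * f1 U"
    by (simp add: algebra_simps)
  finally show ?case
    using insert.hyps by (simp add: subset_avg_insert k_def f1_def)
qed

text \<open>The revealed set has finitely many possible values \<open>B\<close>, so the event is a
  finite union over them.\<close>

lemma determined_reveal:
  assumes "finite U" "g ` U \<subseteq> K" "\<And>B. B \<subseteq> U \<Longrightarrow> determined K (E B)"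
  shows "determined K (\<lambda>\<omega>. E {u\<in>U. \<omega> (g u)} \<omega>)"
proof -
  have "E {u\<in>U. \<omega> (g u)} \<omega> \<longleftrightarrow> (\<exists>B\<in>Pow U. (\<forall>u\<in>U. if u \<in> B then \<omega> (g u) else \<not> \<omega> (g u)) \<and> E B \<omega>)"
    (is "?L \<longleftrightarrow> ?R") for \<omega>
  proof
    assume ?L
    then show ?R by (intro bexI[of _ "{u\<in>U. \<omega> (g u)}"]) auto
  next
    assume ?R
    then obtain B where B: "B \<subseteq> U" "\<forall>u\<in>U. if u \<in> B then \<omega> (g u) else \<not> \<omega> (g u)" "E B \<omega>"
      by blast
    then have "{u\<in>U. \<omega> (g u)} = B" by (auto split: if_splits)
    then show ?L using B(3) by (simp only:)
  qed
  moreover have "determined K (\<lambda>\<omega>. if u \<in> B then \<omega> (g u) else \<not> \<omega> (g u))" if "u \<in> U" for u B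
    using that assms(2) by (cases "u \<in> B") (auto intro!: determined_not determined_coord)
  then have "determined K (\<lambda>\<omega>. \<exists>B\<in>Pow U. (\<forall>u\<in>U. if u \<in> B then \<omega> (g u) else \<not> \<omega> (g u)) \<and> E B \<omega>)"
    using assms by (intro determined_bex determined_conj determined_ball) (auto intro: countable_finite)
  ultimately show ?thesis by presburger
qed

lemma Pr_reveal:
  assumes U: "finite U" "inj_on g U" "g ` U \<subseteq> I" and p: "0 \<le> p" "p \<le> 1"
    and E: "\<And>B. B \<subseteq> U \<Longrightarrow> determined (I - g ` U) (E B)"
  shows "Pr I p (\<lambda>\<omega>. E {u\<in>U. \<omega> (g u)} \<omega>) =
    subset_avg p U (\<lambda>B. Pr I p (E B))"
proof -
  let ?P = "\<lambda>B \<omega>. \<forall>j\<in>g ` U. \<omega> j = (j \<in> g ` B)"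
  have P: "determined (g ` U) (?P B)" for B
    using U by (intro determined_ball) (auto intro: countable_finite simp: determined_def)
  have PE: "?P B \<omega> \<longleftrightarrow> {u\<in>U. \<omega> (g u)} = B" if "B \<subseteq> U" for B \<omega>
    using that inj_on_image_mem_iff[OF U(2)] by auto
  have P0: "?P {u\<in>U. \<omega> (g u)} \<omega>" for \<omega>
    by (subst PE) auto
  \<comment> \<open>The set equation is kept next to \<open>?P B\<close>, although equivalent to it
    for \<open>B\<close> inside \<open>U\<close>: it makes the events disjoint for arbitrary
    \<open>B\<close>, as \<open>Pr_bex_disjoint\<close> demands.\<close>
  have "E {u\<in>U. \<omega> (g u)} \<omega> \<longleftrightarrow> (\<exists>B\<in>Pow U. {u\<in>U. \<omega> (g u)} = B \<and> (?P B \<omega> \<and> E B \<omega>))" for \<omega>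
    using P0[of \<omega>] by (intro iffI bexI[of _ "{u\<in>U. \<omega> (g u)}"]; (elim bexE conjE)?) (simp_all only:, auto)
  then have "Pr I p (\<lambda>\<omega>. E {u\<in>U. \<omega> (g u)} \<omega>) =
        Pr I p (\<lambda>\<omega>. \<exists>B\<in>Pow U. {u\<in>U. \<omega> (g u)} = B \<and> (?P B \<omega> \<and> E B \<omega>))"
    by (simp only:)
  also have "\<dots> = (\<Sum>B\<in>Pow U. Pr I p (\<lambda>\<omega>. {u\<in>U. \<omega> (g u)} = B \<and> (?P B \<omega> \<and> E B \<omega>)))"
  proof (rule Pr_bex_disjoint)
    fix B assume B: "B \<in> Pow U"
    have "(\<lambda>\<omega>. {u\<in>U. \<omega> (g u)} = B \<and> (?P B \<omega> \<and> E B \<omega>)) = (\<lambda>\<omega>. ?P B \<omega> \<and> E B \<omega>)"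
      using PE[of B] B by (intro ext) blast
    then show "determined I (\<lambda>\<omega>. {u\<in>U. \<omega> (g u)} = B \<and> (?P B \<omega> \<and> E B \<omega>))"
      using determined_conj[OF determined_mono[OF P U(3)] determined_mono[OF E]] B by auto
  qed (use U in auto)
  also have "\<dots> = (\<Sum>B\<in>Pow U. Pr I p (?P B) * Pr I p (E B))"
  proof (rule sum.cong)
    fix B assume B: "B \<in> Pow U"
    have "(\<lambda>\<omega>. {u\<in>U. \<omega> (g u)} = B \<and> (?P B \<omega> \<and> E B \<omega>)) = (\<lambda>\<omega>. ?P B \<omega> \<and> E B \<omega>)"
      using PE[of B] B by (intro ext) blast
    then show "Pr I p (\<lambda>\<omega>. {u\<in>U. \<omega> (g u)} = B \<and> (?P B \<omega> \<and> E B \<omega>)) = Pr I p (?P B) * Pr I p (E B)"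
      using Pr_conj_indep[OF P E U(3)] B by auto
  qed simp
  also have "\<dots> = (\<Sum>B\<in>Pow U. (\<Prod>u\<in>U. if u \<in> B then p else 1 - p) * Pr I p (E B))"
  proof (intro sum.cong refl)
    fix B assume "B \<in> Pow U"
    then have "B \<subseteq> U" by simp
    have "Pr I p (?P B) = (\<Prod>j\<in>g ` U. if j \<in> g ` B then p else 1 - p)"
      using U p by (intro Pr_ball) auto
    also have "\<dots> = (\<Prod>u\<in>U. if u \<in> B then p else 1 - p)"
      unfolding prod.reindex[OF U(2)] o_def
      by (intro prod.cong refl) (simp add: inj_on_image_mem_iff[OF U(2) _ \<open>B \<subseteq> U\<close>])
    finally show "Pr I p (?P B) * Pr I p (E B) = (\<Prod>u\<in>U. if u \<in> B then p else 1 - p) * Pr I p (E B)"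
      by simp
  qed
  finally show ?thesis by (simp only: subset_avg_def)
qed

section \<open>Reachable sets\<close>

text \<open>Sources count as reached without any test; only vertices that are entered must lie in
  \<open>D\<close> and be open. An exploration can thus restart from vertices already examined, with
  all further tests confined to a set \<open>D\<close> of unexamined ones.\<close>

definition reach :: "('b \<Rightarrow> 'b \<Rightarrow> bool) \<Rightarrow> 'b set \<Rightarrow> 'b set \<Rightarrow> ('b \<Rightarrow> bool) \<Rightarrow> 'b set" where
  "reach T D s \<omega> = {(x, y). T x y \<and> y \<in> D \<and> \<omega> y}\<^sup>* `` s"

lemma reach_source: "x \<in> s \<Longrightarrow> x \<in> reach T D s \<omega>"
  by (auto simp: reach_def)

lemma reach_step: "x \<in> reach T D s \<omega> \<Longrightarrow> T x y \<Longrightarrow> y \<in> D \<Longrightarrow> \<omega> y \<Longrightarrow> y \<in> reach T D s \<omega>"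
  unfolding reach_def by (auto intro: rtrancl_into_rtrancl)

lemma reach_subsetI:
  assumes "s \<subseteq> Y" "\<And>x y. x \<in> Y \<Longrightarrow> T x y \<Longrightarrow> y \<in> D \<Longrightarrow> \<omega> y \<Longrightarrow> y \<in> Y"
  shows "reach T D s \<omega> \<subseteq> Y"
proof
  fix y assume "y \<in> reach T D s \<omega>"
  then obtain a where "a \<in> s" "(a, y) \<in> {(x, y). T x y \<and> y \<in> D \<and> \<omega> y}\<^sup>*"
    by (auto simp: reach_def)
  from this(2,1) show "y \<in> Y"
    by (induction rule: rtrancl_induct) (use assms in auto)
qed

lemma reach_mono:
  assumes "D \<subseteq> D'" "s \<subseteq> reach T D' s' \<omega>"
  shows "reach T D s \<omega> \<subseteq> reach T D' s' \<omega>"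
  by (rule reach_subsetI[OF assms(2)], erule reach_step) (use assms(1) in auto)

lemma reach_subset: "reach T D s \<omega> \<subseteq> s \<union> D"
  by (rule reach_subsetI) auto

lemma determined_reach:
  assumes "countable D" "countable s" "D \<subseteq> K"
  shows "determined K (\<lambda>\<omega>. y \<in> reach T D s \<omega>)"
proof -
  let ?r = "\<lambda>\<omega>. {(x, y). T x y \<and> y \<in> D \<and> \<omega> y}"
  have n: "determined K (\<lambda>\<omega>. \<exists>a\<in>s. (a, y) \<in> ?r \<omega> ^^ n)" for n
  proof (induction n arbitrary: y)
    case 0
    show ?case using assms by (auto intro!: determined_intros)
  next
    case (Suc n)
    \<comment> \<open>The last but one vertex of a path lies in the countable set
      \<open>s \<union> D\<close>, so the union is countable.\<close>
    have "(\<exists>a\<in>s. (a, y) \<in> ?r \<omega> ^^ Suc n) \<longleftrightarrow>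
      (\<exists>x\<in>s \<union> D. T x y \<and> y \<in> D \<and> \<omega> y \<and> (\<exists>a\<in>s. (a, x) \<in> ?r \<omega> ^^ n))" for \<omega>
    proof -
      have "x \<in> s \<union> D" if "a \<in> s" "(a, x) \<in> ?r \<omega> ^^ n" for a x
        using reach_subset[of T D s \<omega>] that relpow_imp_rtrancl[OF that(2)] by (auto simp: reach_def)
      then show ?thesis by (auto simp: relcomp_unfold)
    qed
    moreover have "determined K (\<lambda>\<omega>. \<exists>x\<in>s \<union> D. T x y \<and> y \<in> D \<and> \<omega> y \<and> (\<exists>a\<in>s. (a, x) \<in> ?r \<omega> ^^ n))"
    proof (cases "y \<in> D")
      case True
      then show ?thesis using assms by (intro determined_intros Suc) auto
    qed (simp add: determined_const)
    ultimately show ?case by presburger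
  qed
  have "y \<in> reach T D s \<omega> \<longleftrightarrow> (\<exists>n\<in>UNIV. \<exists>a\<in>s. (a, y) \<in> ?r \<omega> ^^ n)" for \<omega>
    by (simp add: reach_def Image_iff rtrancl_power) blast
  then show ?thesis
    using determined_bex[of UNIV K "\<lambda>n \<omega>. \<exists>a\<in>s. (a, y) \<in> ?r \<omega> ^^ n", OF _ n] by simp
qed

text \<open>Unlike \<open>card\<close>, this is meaningful for infinite sets. Infinite clusters
  become a decreasing limit of events to which induction on \<open>k\<close> applies.\<close>

definition at_least :: "nat \<Rightarrow> 'b set \<Rightarrow> bool" where
  "at_least k X \<longleftrightarrow> (\<exists>Y\<subseteq>X. finite Y \<and> card Y = k)"

lemma at_least_0: "at_least 0 X"
  by (auto simp: at_least_def intro: exI[of _ "{}"])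

lemma infinite_iff_at_least: "infinite X \<longleftrightarrow> (\<forall>k. at_least k X)"
proof
  assume "\<forall>k. at_least k X"
  then have "at_least (Suc (card X)) X" by blast
  then obtain Y where "Y \<subseteq> X" "finite Y" "card Y = Suc (card X)"
    by (auto simp: at_least_def)
  then show "infinite X" using card_mono[of X Y] by auto
next
  assume "infinite X"
  show "\<forall>k. at_least k X"
  proof
    fix k
    obtain Y where "finite Y" "card Y = k" "Y \<subseteq> X"
      using infinite_arbitrarily_large[OF \<open>infinite X\<close>] by blast
    then show "at_least k X" unfolding at_least_def by (intro exI[of _ Y]) simp
  qed
qed

lemma at_least_mono:
  assumes "at_least k X" "X \<subseteq> Y"
  shows "at_least k Y"
proof -
  obtain Z where "Z \<subseteq> X" "finite Z" "card Z = k"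
    using assms(1) by (auto simp: at_least_def)
  then show ?thesis
    using assms(2) unfolding at_least_def by (intro exI[of _ Z]) simp
qed

lemma at_least_insert:
  assumes "at_least k X" "x \<notin> X"
  shows "at_least (Suc k) (insert x X)"
proof -
  obtain Y where Y: "Y \<subseteq> X" "finite Y" "card Y = k"
    using assms(1) by (auto simp: at_least_def)
  then have "x \<notin> Y" using assms(2) by blast
  with Y have "insert x Y \<subseteq> insert x X \<and> finite (insert x Y) \<and> card (insert x Y) = Suc k"
    by auto
  then show ?thesis unfolding at_least_def by (intro exI)
qed

lemma at_least_Suc:
  assumes "at_least (Suc k) X"
  shows "at_least k X"
proof -
  obtain Y where Y: "Y \<subseteq> X" "finite Y" "card Y = Suc k"
    using assms by (auto simp: at_least_def)
  then obtain y Z where "Y = insert y Z" "card Z = k" "finite Z"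
    by (auto simp: card_Suc_eq_finite)
  then show ?thesis using Y unfolding at_least_def by (intro exI[of _ Z]) auto
qed

lemma determined_at_least:
  assumes "countable D" "countable s" "D \<subseteq> K"
  shows "determined K (\<lambda>\<omega>. at_least k (reach T D s \<omega>))"
proof -
  have "at_least k (reach T D s \<omega>) \<longleftrightarrow>
      (\<exists>Y\<in>{Y. finite Y \<and> Y \<subseteq> s \<union> D}. card Y = k \<and> (\<forall>y\<in>Y. y \<in> reach T D s \<omega>))" for \<omega>
    using reach_subset[of T D s \<omega>] unfolding at_least_def by blast
  moreover have "determined K (\<lambda>\<omega>. \<exists>Y\<in>{Y. finite Y \<and> Y \<subseteq> s \<union> D}. card Y = k \<and> (\<forall>y\<in>Y. y \<in> reach T D s \<omega>))"
    using assms by (intro determined_intros determined_reach countable_Collect_finite_subset)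
      (auto intro: countable_finite)
  ultimately show ?thesis by presburger
qed

lemma determined_infinite_reach:
  assumes "countable D" "countable s" "D \<subseteq> K"
  shows "determined K (\<lambda>\<omega>. infinite (reach T D s \<omega>))"
  unfolding infinite_iff_at_least
  using determined_ball[of UNIV K "\<lambda>k \<omega>. at_least k (reach T D s \<omega>)"] determined_at_least[OF assms] by simp

text \<open>Continuity from above: the events of reaching at least \<open>k\<close> vertices
  decrease to that of reaching infinitely many.\<close>

lemma Pr_infinite_reach:
  assumes "countable D" "countable s" "D \<subseteq> I" "\<And>k. c \<le> Pr I p (\<lambda>\<omega>. at_least k (reach T D s \<omega>))"
  shows "c \<le> Pr I p (\<lambda>\<omega>. infinite (reach T D s \<omega>))"
proof -
  let ?A = "\<lambda>k. {\<omega> \<in> space (bern I p). at_least k (reach T D s \<omega>)}"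
  have "(\<lambda>k. measure (bern I p) (?A k)) \<longlonglongrightarrow> measure (bern I p) (\<Inter>k. ?A k)"
    using determined_at_least[OF assms(1-3)]
    by (intro bern.P.finite_Lim_measure_decseq decseq_SucI)
      (auto intro: determined_sets at_least_Suc)
  moreover have "(\<Inter>k. ?A k) = {\<omega> \<in> space (bern I p). infinite (reach T D s \<omega>)}"
    by (auto simp: infinite_iff_at_least)
  ultimately show ?thesis
    using assms(4) unfolding Pr_def by (intro LIMSEQ_le_const) auto
qed

text \<open>
  A path from \<open>A\<close> that avoids \<open>S\<close> can be cut at its last visit to the out-neighbours of \<open>v\<close>.
\<close>

lemma infinite_reach_reveal:
  assumes "infinite (reach T (V - S) A \<omega>)" and T: "\<And>x y. T x y \<Longrightarrow> y \<in> V"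
    and U: "U = {u. T v u} - S"
  shows "infinite (reach T (V - (S \<union> U)) (A - {v} \<union> {u\<in>U. \<omega> u}) \<omega>)" (is "infinite ?R")
proof -
  \<comment> \<open>Only \<open>v\<close> itself can be lost: a step from \<open>v\<close> into
    \<open>V - S\<close> ends in \<open>U\<close>, whose open vertices are now sources.\<close>
  have "reach T (V - S) A \<omega> \<subseteq> insert v ?R"
  proof (rule reach_subsetI)
    show "A \<subseteq> insert v ?R"
    proof
      fix a assume "a \<in> A"
      then show "a \<in> insert v ?R"
        by (cases "a = v") (simp, intro insertI2 reach_source, simp)
    qed
    fix x y assume *: "x \<in> insert v ?R" "T x y" "y \<in> V - S" "\<omega> y"
    show "y \<in> insert v ?R"
    proof (cases "y \<in> U")
      case True
      then show ?thesis using *(4) by (intro insertI2 reach_source) simp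
    next
      case False
      then have "x \<noteq> v" using *(2,3) U by auto
      then have "x \<in> ?R" using *(1) by (simp only: insert_iff simp_thms)
      then show ?thesis
        using *(3) False by (intro insertI2 reach_step[OF \<open>x \<in> ?R\<close> *(2) _ *(4)]) simp
    qed
  qed
  then have "infinite (insert v ?R)"
    using assms(1) finite_subset by blast
  then show ?thesis by simp
qed

text \<open>Every reached vertex except possibly \<open>a\<close> is reached from some open
  neighbour \<open>u\<close> without re-entering \<open>u\<close>. There are finitely many such
  \<open>u\<close>, so one of these sets is infinite. This drives both Koenig's lemma and the path
  count below.\<close>

lemma infinite_reach_neighbour:
  assumes inf: "infinite (reach T (V - S) {a} \<omega>)" and fin: "finite {u. T a u}"
  obtains u where "T a u" "u \<in> V - S" "\<omega> u" "infinite (reach T (V - insert u S) {u} \<omega>)"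
proof -
  define N where "N = {u. T a u \<and> u \<in> V - S \<and> \<omega> u}"
  let ?Y = "insert a (\<Union>u\<in>N. reach T (V - insert u S) {u} \<omega>)"
  have sub: "reach T (V - S) {a} \<omega> \<subseteq> ?Y"
  proof (rule reach_subsetI)
    fix x y assume *: "x \<in> ?Y" "T x y" "y \<in> V - S" "\<omega> y"
    show "y \<in> ?Y"
    proof (cases "x = a \<or> y \<in> N")
      case True
      then have "y \<in> N" using *(2-4) by (auto simp: N_def)
      then show ?thesis by (intro insertI2 UN_I[of y]) (simp_all add: reach_source)
    next
      case False
      then obtain u where "u \<in> N" "x \<in> reach T (V - insert u S) {u} \<omega>"
        using *(1) by blast
      moreover have "y \<in> reach T (V - insert u S) {u} \<omega>"
      proof (cases "y = u")
        case False
        with *(3) show ?thesis by (intro reach_step[OF \<open>x \<in> reach _ _ _ _\<close> *(2) _ *(4)]) simp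
      qed (simp add: reach_source)
      ultimately show ?thesis by blast
    qed
  qed simp
  have "finite N"
    using fin by (rule rev_finite_subset) (auto simp: N_def)
  moreover have "infinite ?Y"
    using inf finite_subset[OF sub] by blast
  ultimately obtain u where "u \<in> N" "infinite (reach T (V - insert u S) {u} \<omega>)"
    by auto
  then show ?thesis by (intro that) (simp_all add: N_def)
qed

lemma infinite_path_iff_infinite_reach:
  assumes fin: "\<And>x. finite {u. T x u}"
  shows "(\<exists>x. x 0 = a \<and> inj x \<and> (\<forall>n. T (x n) (x (Suc n)) \<and> x (Suc n) \<in> V \<and> \<omega> (x (Suc n)))) \<longleftrightarrow>
    infinite (reach T (V - {a}) {a} \<omega>)" (is "?L \<longleftrightarrow> ?R")
proof
  assume ?L
  then obtain x where x: "x 0 = a" "inj x" "\<And>n. T (x n) (x (Suc n))" "\<And>n. x (Suc n) \<in> V" "\<And>n. \<omega> (x (Suc n))"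
    by blast
  have "x n \<in> reach T (V - {a}) {a} \<omega>" for n
  proof (induction n)
    case (Suc n)
    have "x (Suc n) \<noteq> a"
      using x(1) injD[OF x(2), of "Suc n" 0] by auto
    then show ?case using x(3-5) by (intro reach_step[OF Suc]) simp_all
  qed (simp add: x reach_source)
  then have "range x \<subseteq> reach T (V - {a}) {a} \<omega>" by (rule image_subsetI)
  from finite_subset[OF this] show ?R using range_inj_infinite[OF x(2)] by blast
next
  assume ?R
  \<comment> \<open>A state consists of the current vertex and the set of vertices visited so far.
    Excluding the latter from the remaining search makes the path self-avoiding.\<close>
  define ok where "ok s \<longleftrightarrow> infinite (reach T (V - snd s) {fst s} \<omega>) \<and> fst s \<in> snd s" for s :: "'a \<times> 'a set"
  define next_ok where "next_ok s s' \<longleftrightarrow> T (fst s) (fst s') \<and> fst s' \<in> V - snd s \<and> \<omega> (fst s') \<and>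
      snd s' = insert (fst s') (snd s)" for s s' :: "'a \<times> 'a set"
  have step: "\<exists>s'. ok s' \<and> next_ok s s'" if "ok s" for s
  proof -
    from that have "infinite (reach T (V - snd s) {fst s} \<omega>)" by (simp add: ok_def)
    from this fin obtain u where "T (fst s) u" "u \<in> V - snd s" "\<omega> u"
      "infinite (reach T (V - insert u (snd s)) {u} \<omega>)" by (rule infinite_reach_neighbour)
    then have "ok (u, insert u (snd s)) \<and> next_ok s (u, insert u (snd s))"
      by (simp add: ok_def next_ok_def)
    then show ?thesis by (rule exI)
  qed
  have "ok (a, {a})" using \<open>?R\<close> by (simp add: ok_def)
  \<comment> \<open>Dependent choice fixes no initial value, so the invariant prescribes it at index
    0.\<close>
  then have "\<exists>s. ok s \<and> (0 = (0::nat) \<longrightarrow> s = (a, {a}))" by blast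
  from dependent_nat_choice[where P="\<lambda>n s. ok s \<and> (n = 0 \<longrightarrow> s = (a, {a}))" and Q="\<lambda>_. next_ok", OF this]
  obtain f where "\<And>n. (ok (f n) \<and> (n = 0 \<longrightarrow> f n = (a, {a}))) \<and> next_ok (f n) (f (Suc n))"
    using step by auto
  then have f: "f 0 = (a, {a})" "\<And>n. ok (f n)" "\<And>n. next_ok (f n) (f (Suc n))" by simp_all
  define x where "x n = fst (f n)" for n
  have mono: "snd (f m) \<subseteq> snd (f n)" if "m \<le> n" for m n
    by (rule lift_Suc_mono_le[of "\<lambda>n. snd (f n)", OF _ that]) (use f(3) in \<open>auto simp: next_ok_def\<close>)
  have "x m \<noteq> x n" if mn: "m < n" for m n
  proof -
    obtain n' where n: "n = Suc n'" "m \<le> n'" using mn by (cases n) auto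
    have "x m \<in> snd (f n')" using f(2)[of m] mono[OF n(2)] by (auto simp: ok_def x_def)
    moreover have "x n \<notin> snd (f n')" using f(3)[of n'] n by (auto simp: next_ok_def x_def)
    ultimately show ?thesis by auto
  qed
  then have "inj x" by (rule linorder_injI)
  moreover have "T (x n) (x (Suc n)) \<and> x (Suc n) \<in> V \<and> \<omega> (x (Suc n))" for n
    using f(3)[of n] by (simp add: x_def next_ok_def)
  moreover have "x 0 = a" by (simp add: x_def f(1))
  ultimately show ?L by blast
qed

section \<open>Comparison of a graph with its ladder\<close>

text \<open>Percolation follows edges in their permitted direction only, so a step relation with
  bounded out-degree covers oriented and unoriented graphs alike.\<close>

locale bounded_graph =
  fixes V :: "'a set" and T :: "'a \<Rightarrow> 'a \<Rightarrow> bool" and D :: nat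
  assumes countable_V: "countable V"
    and T_in_V: "T x y \<Longrightarrow> y \<in> V"
    and finite_T: "finite {y. T x y}"
    and card_T: "card {y. T x y} \<le> D"
begin

lemma determined_inf_reach:
  "finite s \<Longrightarrow> V - S \<subseteq> K \<Longrightarrow> determined K (\<lambda>\<omega>. infinite (reach T (V - S) s \<omega>))"
  using countable_V by (intro determined_infinite_reach) (auto intro: countable_finite)

text \<open>Path counting, one vertex at a time: an infinite cluster continues through one of at
  most \<open>D\<close> neighbours \<open>u\<close>. Each is open with probability \<open>p\<close>,
  independently of the continuation, which never tests \<open>u\<close> again.\<close>

lemma Pr_infinite_reach_le:
  fixes p :: real
  assumes "0 \<le> p" "p \<le> 1"
  shows "Pr V p (\<lambda>\<omega>. infinite (reach T (V - S) {a} \<omega>)) \<le> (D * p) ^ k"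
proof (induction k arbitrary: a S)
  case 0
  show ?case by (simp add: Pr_le_1)
next
  case (Suc k)
  let ?N = "{u. T a u} - S"
  have det: "determined (V - {u}) (\<lambda>\<omega>. infinite (reach T (V - insert u S) {u} \<omega>))" for u
    by (intro determined_inf_reach) auto
  have u: "determined {u} (\<lambda>\<omega>. \<omega> u)" for u :: 'a
    by (simp add: determined_coord)
  have "Pr V p (\<lambda>\<omega>. infinite (reach T (V - S) {a} \<omega>)) \<le>
      Pr V p (\<lambda>\<omega>. \<exists>u\<in>?N. \<omega> u \<and> infinite (reach T (V - insert u S) {u} \<omega>))"
  proof (rule Pr_mono)
    show "determined V (\<lambda>\<omega>. \<exists>u\<in>?N. \<omega> u \<and> infinite (reach T (V - insert u S) {u} \<omega>))"
      using finite_T T_in_V by (intro determined_intros determined_inf_reach) (auto intro: countable_finite)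
    fix \<omega> assume "infinite (reach T (V - S) {a} \<omega>)"
    from infinite_reach_neighbour[OF this finite_T]
    show "\<exists>u\<in>?N. \<omega> u \<and> infinite (reach T (V - insert u S) {u} \<omega>)" by blast
  qed
  also have "\<dots> \<le> (\<Sum>u\<in>?N. Pr V p (\<lambda>\<omega>. \<omega> u \<and> infinite (reach T (V - insert u S) {u} \<omega>)))"
    using finite_T T_in_V by (intro Pr_bex determined_intros determined_inf_reach) auto
  also have "\<dots> = (\<Sum>u\<in>?N. p * Pr V p (\<lambda>\<omega>. infinite (reach T (V - insert u S) {u} \<omega>)))"
  proof (intro sum.cong refl)
    fix u assume "u \<in> ?N"
    then have "{u} \<subseteq> V" using T_in_V by auto
    then show "Pr V p (\<lambda>\<omega>. \<omega> u \<and> infinite (reach T (V - insert u S) {u} \<omega>)) =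
        p * Pr V p (\<lambda>\<omega>. infinite (reach T (V - insert u S) {u} \<omega>))"
      using Pr_conj_indep[OF u det] Pr_ball[of "{u}" V p "\<lambda>_. True"] assms by simp
  qed
  also have "\<dots> \<le> (\<Sum>u\<in>?N. p * (D * p) ^ k)"
    using assms Suc.IH by (intro sum_mono mult_left_mono) auto
  also have "\<dots> \<le> D * (p * (D * p) ^ k)"
  proof -
    have "card ?N \<le> D"
      using card_mono[OF finite_T, of ?N a] card_T[of a] by simp
    then show ?thesis using assms by (simp add: mult_right_mono)
  qed
  finally show ?case by (simp add: mult_ac)
qed

lemma Pr_infinite_reach_eq_0:
  fixes p :: real
  assumes "0 \<le> p" "p \<le> 1" "D * p < 1"
  shows "Pr V p (\<lambda>\<omega>. infinite (reach T (V - S) {a} \<omega>)) = 0"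
proof (rule antisym)
  have "(\<lambda>k. (D * p) ^ k) \<longlonglongrightarrow> 0"
    using assms by (intro LIMSEQ_realpow_zero) auto
  then show "Pr V p (\<lambda>\<omega>. infinite (reach T (V - S) {a} \<omega>)) \<le> 0"
    by (rule LIMSEQ_le_const) (use Pr_infinite_reach_le[OF assms(1,2)] in blast)
qed (simp add: Pr_nonneg)

section \<open>Exploration of the ladder\<close>

definition ladder_step :: "'a \<times> nat \<Rightarrow> 'a \<times> nat \<Rightarrow> bool" where
  "ladder_step x y \<longleftrightarrow> T (fst x) (fst y) \<and> snd y = snd x \<or>
     fst x \<in> V \<and> fst y = fst x \<and> snd y = Suc (snd x)"

lemma finite_ladder_step: "finite {y. ladder_step x y}"
proof (rule finite_subset)
  show "{y. ladder_step x y} \<subseteq> insert (fst x, Suc (snd x)) ((\<lambda>u. (u, snd x)) ` {u. T (fst x) u})"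
    by (auto simp: ladder_step_def image_iff prod_eq_iff)
qed (simp add: finite_T)

text \<open>
  State of an exploration of the ladder: the vertices of the graph in \<open>S\<close> have been seen, and for
  those in \<open>A\<close> it is known that they are reached at height \<open>h\<close> but nothing about greater heights.
\<close>

definition fresh :: "'a set \<Rightarrow> ('a \<Rightarrow> nat) \<Rightarrow> 'a set \<Rightarrow> ('a \<times> nat) set" where
  "fresh A h S = {(u, n). u \<in> V \<and> (u \<notin> S \<or> u \<in> A \<and> h u < n)}"

definition explored :: "'a set \<Rightarrow> ('a \<Rightarrow> nat) \<Rightarrow> 'a set \<Rightarrow> ('a \<times> nat \<Rightarrow> bool) \<Rightarrow> ('a \<times> nat) set" where
  "explored A h S = reach ladder_step (fresh A h S) ((\<lambda>a. (a, h a)) ` A)"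

lemma countable_fresh: "countable (fresh A h S)"
  by (rule countable_subset[of _ "V \<times> UNIV"]) (auto simp: fresh_def countable_V)

lemma determined_explored:
  "finite A \<Longrightarrow> fresh A h S \<subseteq> K \<Longrightarrow> determined K (\<lambda>\<omega>. at_least k (explored A h S \<omega>))"
  unfolding explored_def
  by (intro determined_at_least countable_fresh countable_finite finite_imageI)

text \<open>What the new state explores is contained in what the old one explores, but it misses
  \<open>(v, h v)\<close>: \<open>v\<close> has been seen and is no longer active, so its column is
  never entered again. Hence the count grows by one.\<close>

lemma at_least_explored_step:
  assumes v: "v \<in> A" and A: "A \<subseteq> S" and U: "U = {u. T v u} - S" and B: "B \<subseteq> U"
    and h: "\<And>a. a \<in> A \<Longrightarrow> h' a = h a"
    and reached: "\<And>u. u \<in> B \<Longrightarrow> (u, h' u) \<in> explored A h S \<omega>"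
    and k: "at_least k (explored (A - {v} \<union> B) h' (S \<union> U) \<omega>)"
  shows "at_least (Suc k) (explored A h S \<omega>)"
proof -
  have fresh: "fresh (A - {v} \<union> B) h' (S \<union> U) \<subseteq> fresh A h S"
    using B U h A by (auto simp: fresh_def)
  have source: "(a, h a) \<in> explored A h S \<omega>" if "a \<in> A" for a
    unfolding explored_def using that by (intro reach_source imageI)
  have "(\<lambda>a. (a, h' a)) ` (A - {v} \<union> B) \<subseteq> explored A h S \<omega>"
    using source reached h by (auto simp del: insert_iff)
  with fresh have "explored (A - {v} \<union> B) h' (S \<union> U) \<omega> \<subseteq> explored A h S \<omega>"
    unfolding explored_def by (rule reach_mono)
  with source[OF v] have sub: "insert (v, h v) (explored (A - {v} \<union> B) h' (S \<union> U) \<omega>) \<subseteq> explored A h S \<omega>"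
    by simp
  have "v \<notin> B" using A v B U by auto
  then have "(v, h v) \<notin> fresh (A - {v} \<union> B) h' (S \<union> U) \<union> (\<lambda>a. (a, h' a)) ` (A - {v} \<union> B)"
    using v A by (auto simp: fresh_def)
  then have "(v, h v) \<notin> explored (A - {v} \<union> B) h' (S \<union> U) \<omega>"
    using reach_subset[of ladder_step "fresh (A - {v} \<union> B) h' (S \<union> U)"] unfolding explored_def by blast
  from at_least_mono[OF at_least_insert[OF k this] sub] show ?thesis .
qed

text \<open>
  One exploration step tries every new out-neighbour \<open>u\<close> of \<open>v\<close> at the height of \<open>v\<close>, and the ones
  that fail a second time one level higher; only the case that all of these second attempts
  succeed is used.
\<close>

lemma Pr_explored_step:
  assumes p: "0 \<le> p" "p \<le> 1" and v: "v \<in> A" and A: "A \<subseteq> S" "S \<subseteq> V" "finite A"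
    and U: "U = {u. T v u} - S"
    and F: "\<And>B h'. B \<subseteq> U \<Longrightarrow>
      F B \<le> Pr (V \<times> UNIV) p (\<lambda>\<omega>. at_least k (explored (A - {v} \<union> B) h' (S \<union> U) \<omega>))"
    and mono: "\<And>B C. B \<subseteq> C \<Longrightarrow> C \<subseteq> U \<Longrightarrow> F B \<le> F C"
    and c: "c \<le> p ^ Suc D"
  shows "(1 - c) * subset_avg p U F + c * F U \<le>
    Pr (V \<times> UNIV) p (\<lambda>\<omega>. at_least (Suc k) (explored A h S \<omega>))"
proof -
  let ?I = "V \<times> (UNIV :: nat set)"
  define n where "n = h v"
  \<comment> \<open>Here \<open>B\<close> is the set of \<open>u\<close> open at height
    \<open>n\<close>. These stay at height \<open>n\<close>, the other new vertices move to
    \<open>Suc n\<close>, and \<open>C B\<close> collects the vertices that must be open for every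
    second attempt to succeed.\<close>
  define h' where "h' B = (\<lambda>x. if x \<in> A then h x else if x \<in> B then n else Suc n)" for B
  define C where "C B = insert (v, Suc n) ((U - B) \<times> {Suc n})" for B
  define X where "X B B' \<omega> = at_least k (explored (A - {v} \<union> B') (h' B) (S \<union> U) \<omega>)" for B B' \<omega>
  define E where "E B \<omega> = (if \<forall>x\<in>C B. \<omega> x = True then X B U \<omega> else X B B \<omega>)" for B \<omega>
  have finU: "finite U" and UV: "U \<subseteq> V" and cardU: "card U \<le> D"
    using finite_T[of v] card_T[of v] card_mono[OF finite_T[of v], of U] T_in_V by (auto simp: U)
  have UA: "u \<notin> A" "u \<notin> S" if "u \<in> U" for u
    using that A U by auto
  have vU: "v \<notin> U" and vV: "v \<in> V" and vS: "v \<in> S"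
    using v A U by auto
  have finC: "finite (C B)" for B
    using finU by (simp add: C_def)
  have CI: "C B \<subseteq> ?I" "C B \<subseteq> ?I - (\<lambda>u. (u, n)) ` U" for B
    using UV vV by (auto simp: C_def)
  have detX: "determined K (X B B')" if "B' \<subseteq> U" "fresh (A - {v} \<union> B') (h' B) (S \<union> U) \<subseteq> K" for B B' K
    unfolding X_def using A(3) that finite_subset[OF that(1) finU] by (intro determined_explored) simp_all
  have fresh: "fresh (A - {v} \<union> B') (h' B) (S \<union> U) \<subseteq> ?I - (\<lambda>u. (u, n)) ` U" 
    if "B \<subseteq> U" "B' \<subseteq> U" for B B'
    using that UA by (auto simp: fresh_def h'_def split: if_splits)
  \<comment> \<open>Neither continuation looks at \<open>C B\<close>: a failed \<open>u\<close> is
    either active at height \<open>Suc n\<close>, hence fresh only above it, or seen and not active;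
    the column of \<open>v\<close> is abandoned.\<close>
  have freshU: "fresh (A - {v} \<union> U) (h' B) (S \<union> U) \<subseteq> ?I - C B" if "B \<subseteq> U" for B
    using that UA vU vS by (auto simp: fresh_def h'_def C_def split: if_splits)
  have freshB: "fresh (A - {v} \<union> B) (h' B) (S \<union> U) \<subseteq> ?I - C B" if "B \<subseteq> U" for B
    using that UA vU vS by (auto simp: fresh_def h'_def C_def split: if_splits)
  have detC: "determined K (\<lambda>\<omega>. \<forall>x\<in>C B. \<omega> x = True)" if "C B \<subseteq> K" for B K
    using that finC by (intro determined_ball) (auto intro: countable_finite determined_coord)
  have detE: "determined (?I - (\<lambda>u. (u, n)) ` U) (E B)" if "B \<subseteq> U" for B
  proof -
    have "E B = (\<lambda>\<omega>. (\<forall>x\<in>C B. \<omega> x = True) \<and> X B U \<omega> \<or> \<not> (\<forall>x\<in>C B. \<omega> x = True) \<and> X B B \<omega>)"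
      by (auto simp: E_def fun_eq_iff)
    then show ?thesis
      using that fresh[OF that] CI
      by (simp only:) (intro determined_disj determined_conj determined_not detX detC; simp)
  qed
  have E: "at_least (Suc k) (explored A h S \<omega>)" if "E {u\<in>U. \<omega> (u, n)} \<omega>" for \<omega>
  proof -
    define B where "B = {u\<in>U. \<omega> (u, n)}"
    have source: "(v, n) \<in> explored A h S \<omega>"
      unfolding explored_def n_def using v by (intro reach_source imageI)
    have at_n: "(u, n) \<in> explored A h S \<omega>" if "u \<in> B" for u
      using that UA[of u] UV source unfolding explored_def
      by (elim reach_step) (auto simp: B_def U ladder_step_def fresh_def)
    show ?thesis
    proof (cases "\<forall>x\<in>C B. \<omega> x = True")
      case True
      have up: "(v, Suc n) \<in> explored A h S \<omega>"
        using True v vV source unfolding explored_def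
        by (elim reach_step) (auto simp: C_def ladder_step_def fresh_def n_def)
      have "(u, Suc n) \<in> explored A h S \<omega>" if "u \<in> U" "u \<notin> B" for u
        using that True UA[of u] UV up unfolding explored_def
        by (elim reach_step) (auto simp: C_def U ladder_step_def fresh_def)
      with at_n have "(u, h' B u) \<in> explored A h S \<omega>" if "u \<in> U" for u
        using that UA[of u] by (simp add: h'_def)
      moreover have "X B U \<omega>" using True \<open>E _ _\<close> by (simp add: E_def flip: B_def)
      ultimately show ?thesis
        by (intro at_least_explored_step[OF v A(1) U, of U "h' B"]) (auto simp: h'_def X_def)
    next
      case False
      then have "X B B \<omega>" using \<open>E _ _\<close> by (simp only: E_def if_False flip: B_def)
      moreover have "(u, h' B u) \<in> explored A h S \<omega>" if "u \<in> B" for u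
        using at_n[OF that] that UA[of u] by (simp add: h'_def B_def)
      ultimately show ?thesis
        by (intro at_least_explored_step[OF v A(1) U, of B "h' B"]) (auto simp: h'_def X_def B_def)
    qed
  qed
  have PrE: "(1 - c) * F B + c * F U \<le> Pr ?I p (E B)" if B: "B \<subseteq> U" for B
  proof -
    \<comment> \<open>\<open>C B\<close> has at most \<open>D + 1\<close> elements, so
      \<open>c \<le> p ^ Suc D \<le> r\<close>. As \<open>F B \<le> F U\<close>, replacing the
      weight \<open>c\<close> by \<open>r\<close> can only increase the mixture.\<close>
    define r where "r = Pr ?I p (\<lambda>\<omega>. \<forall>x\<in>C B. \<omega> x = True)"
    have "r = p ^ card (C B)"
      unfolding r_def using Pr_ball[OF finC[of B] CI(1) p, of "\<lambda>_. True"] by simp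
    moreover have "card (C B) \<le> Suc D"
    proof -
      have "card (C B) \<le> Suc (card ((U - B) \<times> {Suc n}))"
        unfolding C_def by (rule card_insert_le_m1) simp_all
      also have "card ((U - B) \<times> {Suc n}) \<le> card U"
        using card_mono[OF finU, of "U - B"] by (simp add: card_cartesian_product)
      finally show ?thesis using cardU by simp
    qed
    ultimately have r: "c \<le> r" "r \<le> 1"
      using c p power_decreasing[of "card (C B)" "Suc D" p] by (auto simp: power_le_one)
    have "(1 - c) * F B + c * F U = F B + c * (F U - F B)"
      by (simp add: algebra_simps)
    also have "\<dots> \<le> F B + r * (F U - F B)"
      using r mono[OF B] by (intro add_left_mono mult_right_mono) auto
    also have "\<dots> = r * F U + (1 - r) * F B"
      by (simp add: algebra_simps)
    also have "\<dots> \<le> r * Pr ?I p (X B U) + (1 - r) * Pr ?I p (X B B)"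
    proof (intro add_mono mult_left_mono)
      show "F U \<le> Pr ?I p (X B U)" unfolding X_def by (rule F) simp
      show "F B \<le> Pr ?I p (X B B)" unfolding X_def by (rule F[OF B])
      show "0 \<le> r" by (simp add: r_def Pr_nonneg)
      show "0 \<le> 1 - r" using r by simp
    qed
    also have "\<dots> = Pr ?I p (E B)"
      unfolding r_def E_def
      by (intro Pr_if[symmetric, of "C B"] detC detX freshU freshB B CI order_refl)
    finally show ?thesis .
  qed
  have "(1 - c) * subset_avg p U F + c * F U = subset_avg p U (\<lambda>B. (1 - c) * F B + c * F U)"
    by (simp add: subset_avg_affine finU)
  also have "\<dots> \<le> subset_avg p U (\<lambda>B. Pr ?I p (E B))"
    using p PrE by (intro subset_avg_mono)
  also have "\<dots> = Pr ?I p (\<lambda>\<omega>. E {u\<in>U. \<omega> (u, n)} \<omega>)"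
    by (rule Pr_reveal[symmetric]) (use finU UV p detE in \<open>auto simp: inj_on_def\<close>)
  also have "\<dots> \<le> Pr ?I p (\<lambda>\<omega>. at_least (Suc k) (explored A h S \<omega>))"
    using A(3) E by (intro Pr_mono determined_explored) (auto simp: fresh_def)
  finally show ?thesis .
qed

text \<open>Induction on \<open>k\<close>, processing the same \<open>v\<close> on both sides. In
  the graph, sprinkling bounds the average at \<open>q\<close> by a mixture of the average at
  \<open>p\<close> and the value at all of \<open>U\<close>; in the ladder, the second attempts give
  the value at \<open>U\<close> at least the same weight. The graph side ignores heights, so the
  induction hypothesis serves every \<open>h\<close>.\<close>

lemma Pr_infinite_reach_le_explored:
  fixes p q :: real
  assumes p: "0 < p" "p < q" "q \<le> 1" and pq: "D * (q - p) \<le> (1 - p) * p ^ Suc D"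
    and "finite A" "A \<subseteq> S" "S \<subseteq> V"
  shows "Pr V q (\<lambda>\<omega>. infinite (reach T (V - S) A \<omega>)) \<le>
    Pr (V \<times> UNIV) p (\<lambda>\<omega>. at_least k (explored A h S \<omega>))"
  using assms(5-)
proof (induction k arbitrary: A h S)
  case 0
  show ?case by (simp add: at_least_0 Pr_True Pr_le_1)
next
  case (Suc k)
  show ?case
  proof (cases "A = {}")
    case True
    then show ?thesis by (simp add: reach_def Pr_False Pr_nonneg)
  next
    case False
    then obtain v where v: "v \<in> A" by blast
    define U where "U = {u. T v u} - S"
    define F where "F B = Pr V q (\<lambda>\<omega>. infinite (reach T (V - (S \<union> U)) (A - {v} \<union> B) \<omega>))" for B
    define d where "d = (q - p) / (1 - p)"
    have finU: "finite U" and UV: "U \<subseteq> V" and cardU: "card U \<le> D"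
      using finite_T[of v] card_T[of v] card_mono[OF finite_T[of v], of U] T_in_V by (auto simp: U_def)
    have det: "determined K (\<lambda>\<omega>. infinite (reach T (V - (S \<union> U)) (A - {v} \<union> B) \<omega>))"
      if "B \<subseteq> U" "V - (S \<union> U) \<subseteq> K" for B K
      using that Suc.prems(1) finite_subset[OF that(1) finU] by (intro determined_inf_reach) simp_all
    have d: "0 \<le> d" "d \<le> 1" and q: "1 - q = (1 - p) * (1 - d)"
      using p by (auto simp: d_def field_simps)
    have mono: "F B \<le> F C" if "B \<subseteq> C" "C \<subseteq> U" for B C
      unfolding F_def
    proof (rule Pr_mono)
      fix \<omega> assume inf: "infinite (reach T (V - (S \<union> U)) (A - {v} \<union> B) \<omega>)"
      have "reach T (V - (S \<union> U)) (A - {v} \<union> B) \<omega> \<subseteq> reach T (V - (S \<union> U)) (A - {v} \<union> C) \<omega>"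
      proof (rule reach_mono[OF order_refl])
        show "A - {v} \<union> B \<subseteq> reach T (V - (S \<union> U)) (A - {v} \<union> C) \<omega>"
        proof
          fix x assume "x \<in> A - {v} \<union> B"
          then show "x \<in> reach T (V - (S \<union> U)) (A - {v} \<union> C) \<omega>"
            using that(1) by (intro reach_source) blast
        qed
      qed
      from finite_subset[OF this] inf
      show "infinite (reach T (V - (S \<union> U)) (A - {v} \<union> C) \<omega>)" by blast
    qed (use det that in simp)
    have "Pr V q (\<lambda>\<omega>. infinite (reach T (V - S) A \<omega>)) \<le>
        Pr V q (\<lambda>\<omega>. infinite (reach T (V - (S \<union> U)) (A - {v} \<union> {u\<in>U. \<omega> u}) \<omega>))"
    proof (rule Pr_mono)
      show "determined V (\<lambda>\<omega>. infinite (reach T (V - (S \<union> U)) (A - {v} \<union> {u\<in>U. \<omega> u}) \<omega>))"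
        by (rule determined_reveal[where g="\<lambda>u. u" and E="\<lambda>B \<omega>. infinite (reach T (V - (S \<union> U)) (A - {v} \<union> B) \<omega>)"])
          (use finU UV det in auto)
      fix \<omega> assume "infinite (reach T (V - S) A \<omega>)"
      then show "infinite (reach T (V - (S \<union> U)) (A - {v} \<union> {u\<in>U. \<omega> u}) \<omega>)"
        using T_in_V U_def by (rule infinite_reach_reveal)
    qed
    also have "\<dots> = subset_avg q U F"
      unfolding F_def
    proof (rule Pr_reveal[where g="\<lambda>u. u" and E="\<lambda>B \<omega>. infinite (reach T (V - (S \<union> U)) (A - {v} \<union> B) \<omega>)"])
      fix B assume "B \<subseteq> U"
      then show "determined (V - (\<lambda>u. u) ` U) (\<lambda>\<omega>. infinite (reach T (V - (S \<union> U)) (A - {v} \<union> B) \<omega>))"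
        by (rule det) auto
    qed (use finU UV p in simp_all)
    also have "\<dots> \<le> (1 - d) ^ card U * subset_avg p U F + (1 - (1 - d) ^ card U) * F U"
      using finU q d p mono by (intro subset_avg_sprinkle) auto
    also have "\<dots> = (1 - (1 - (1 - d) ^ card U)) * subset_avg p U F + (1 - (1 - d) ^ card U) * F U"
      by simp
    also have "\<dots> \<le> Pr (V \<times> UNIV) p (\<lambda>\<omega>. at_least (Suc k) (explored A h S \<omega>))"
    proof (rule Pr_explored_step[OF _ _ v _ _ _ U_def _ mono])
      show "F B \<le> Pr (V \<times> UNIV) p (\<lambda>\<omega>. at_least k (explored (A - {v} \<union> B) h' (S \<union> U) \<omega>))"
        if "B \<subseteq> U" for B h'
        unfolding F_def using that finite_subset[OF that finU] UV Suc.prems by (intro Suc.IH) auto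
      \<comment> \<open>The weight of \<open>U\<close> after sprinkling is at most
        \<open>D * d\<close> by Bernoulli's inequality, and \<open>pq\<close> says that this is at
        most the probability of \<open>D + 1\<close> vertices being open.\<close>
      have "1 - (1 - d) ^ card U \<le> card U * d"
        using Bernoulli_inequality[of "- d" "card U"] d by simp
      also have "\<dots> \<le> D * d"
        using cardU d by (intro mult_right_mono) auto
      also have "\<dots> \<le> p ^ Suc D"
        using pq p by (simp add: d_def field_simps)
      finally show "1 - (1 - d) ^ card U \<le> p ^ Suc D" .
    qed (use p Suc.prems in auto)
    finally show ?thesis .
  qed
qed

end

section \<open>Transfer to mixed graphs and their ladders\<close>

lemma countable_rtrancl_Image:
  assumes "\<And>x. countable (r `` {x})"
  shows "countable (r\<^sup>* `` {a})"
proof -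
  have "countable ((r ^^ n) `` {a})" for n
  proof (induction n)
    case (Suc n)
    have "(r ^^ Suc n) `` {a} = (\<Union>x\<in>(r ^^ n) `` {a}. r `` {x})"
      by auto
    then show ?case using Suc assms by simp
  qed simp
  moreover have "r\<^sup>* `` {a} = (\<Union>n. (r ^^ n) `` {a})"
    by (auto simp: rtrancl_power)
  ultimately show ?thesis by simp
qed

text \<open>Koenig's lemma with the openness of the start split off; the two factors look at
  disjoint sets of vertices.\<close>

lemma reaches_infinity_iff:
  assumes fin: "\<And>x. finite {u. traversable G x u}" and v0: "v0 \<in> verts G"
  shows "reaches_infinity G \<omega> v0 \<longleftrightarrow> \<omega> v0 \<and> infinite (reach (traversable G) (verts G - {v0}) {v0} \<omega>)"
proof -
  have "(x 0 = v0 \<and> inj x \<and> (\<forall>n. x n \<in> verts G \<and> \<omega> (x n)) \<and> (\<forall>n. traversable G (x n) (x (Suc n)))) \<longleftrightarrow>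
      \<omega> v0 \<and> (x 0 = v0 \<and> inj x \<and>
        (\<forall>n. traversable G (x n) (x (Suc n)) \<and> x (Suc n) \<in> verts G \<and> \<omega> (x (Suc n))))" (is "?L \<longleftrightarrow> ?R") for x
  proof
    assume x: ?R
    have "x n \<in> verts G \<and> \<omega> (x n)" for n
      using x v0 by (cases n) simp_all
    with x show ?L by simp
  next
    assume x: ?L
    then have "\<omega> (x 0)" by blast
    with x show ?R by simp
  qed
  then have "reaches_infinity G \<omega> v0 \<longleftrightarrow> \<omega> v0 \<and> (\<exists>x. x 0 = v0 \<and> inj x \<and>
      (\<forall>n. traversable G (x n) (x (Suc n)) \<and> x (Suc n) \<in> verts G \<and> \<omega> (x (Suc n))))"
    unfolding reaches_infinity_def by (simp only: ex_simps)
  also have "\<dots> \<longleftrightarrow> \<omega> v0 \<and> infinite (reach (traversable G) (verts G - {v0}) {v0} \<omega>)"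
    by (simp only: infinite_path_iff_infinite_reach[of "traversable G", OF fin])
  finally show ?thesis .
qed

lemma percolation_prob_eq: "percolation_prob G v0 p = Pr (verts G) p (\<lambda>\<omega>. reaches_infinity G \<omega> v0)"
  by (simp add: percolation_prob_def site_percolation_def Pr_def)

lemma bounded_graphI:
  assumes G: "oriented_graph G \<or> unoriented_graph G" and con: "connected_graph G"
    and deg: "bounded_degree G" and v0: "v0 \<in> verts G"
  obtains D where "D > 0" "bounded_graph (verts G) (traversable G) D"
proof -
  let ?inc = "\<lambda>x. {e \<in> underlying_edges G. x \<in> e}"
  obtain D where D: "finite (?inc v)" "card (?inc v) \<le> D" if "v \<in> verts G" for v
    using deg by (auto simp: bounded_degree_def)
  have in_verts: "e \<subseteq> verts G" if "e \<in> underlying_edges G" for e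
    using G that by (auto simp: underlying_edges_def oriented_graph_def unoriented_graph_def)
  have edge: "{x, y} \<in> underlying_edges G" if "traversable G x y" for x y
    using that by (auto simp: underlying_edges_def traversable_def)
  \<comment> \<open>The degree counts incident edges; this injection turns it into a bound on the
    number of neighbours.\<close>
  have inj: "inj_on (\<lambda>y. {x, y}) Y" for x :: 'a and Y
    by (auto simp: inj_on_def doubleton_eq_iff)
  have nbrs: "finite {y. {x, y} \<in> underlying_edges G} \<and> card {y. {x, y} \<in> underlying_edges G} \<le> D" for x
  proof (cases "x \<in> verts G")
    case True
    have sub: "(\<lambda>y. {x, y}) ` {y. {x, y} \<in> underlying_edges G} \<subseteq> ?inc x"
      by auto
    have "finite {y. {x, y} \<in> underlying_edges G}"
      by (rule finite_imageD[OF finite_subset[OF sub D(1)[OF True]] inj])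
    moreover have "card {y. {x, y} \<in> underlying_edges G} \<le> card (?inc x)"
      by (rule card_inj_on_le[OF inj sub D(1)[OF True]])
    ultimately show ?thesis using D(2)[OF True] by simp
  next
    case False
    then have "{y. {x, y} \<in> underlying_edges G} = {}" using in_verts by blast
    then show ?thesis by simp
  qed
  \<comment> \<open>By connectedness every vertex is finitely many steps from \<open>v0\<close>, and
    neighbourhoods are finite, so there are countably many vertices.\<close>
  let ?r = "{(x, y). {x, y} \<in> underlying_edges G}"
  have "countable (verts G)"
  proof (rule countable_subset)
    show "verts G \<subseteq> ?r\<^sup>* `` {v0}"
      using con v0 unfolding connected_graph_def by blast
    show "countable (?r\<^sup>* `` {v0})"
      using nbrs by (intro countable_rtrancl_Image) (simp add: Image_def countable_finite)
  qed
  moreover have "y \<in> verts G" if "traversable G x y" for x y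
    using in_verts[OF edge[OF that]] by simp
  moreover have "finite {y. traversable G x y} \<and> card {y. traversable G x y} \<le> Suc D" for x
  proof -
    have sub: "{y. traversable G x y} \<subseteq> {y. {x, y} \<in> underlying_edges G}"
      using edge by auto
    then show ?thesis
      using nbrs[of x] finite_subset[OF sub] card_mono[OF _ sub] by auto
  qed
  ultimately show ?thesis
    \<comment> \<open>The successor makes the bound positive, so that one may divide by it.\<close>
    by (intro that[of "Suc D"]) (simp_all add: bounded_graph_def)
qed

lemma verts_ladder: "verts (ladder G) = verts G \<times> UNIV"
  by (simp add: ladder_def)

lemma traversable_ladder:
  assumes "bounded_graph (verts G) (traversable G) D"
  shows "traversable (ladder G) = bounded_graph.ladder_step (verts G) (traversable G)"
proof (intro ext)
  fix x y :: "'a \<times> nat"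
  obtain u n v m where xy: "x = (u, n)" "y = (v, m)" by (cases x; cases y) auto
  show "traversable (ladder G) x y = bounded_graph.ladder_step (verts G) (traversable G) x y"
    unfolding bounded_graph.ladder_step_def[OF assms] xy
    by (auto simp: traversable_def ladder_def doubleton_eq_iff insert_commute)
qed

text \<open>The exploration starts with the origin as the only seen and active vertex. It never
  tests \<open>(v0, 0)\<close>, whose openness is therefore independent of it and contributes a
  factor \<open>p\<close>.\<close>

lemma percolation_prob_ladder_pos:
  fixes p q :: real
  assumes G: "bounded_graph (verts G) (traversable G) D" and v0: "v0 \<in> verts G"
    and p: "0 < p" "p < q" "q \<le> 1" and pq: "D * (q - p) \<le> (1 - p) * p ^ Suc D"
    and pos: "percolation_prob G v0 q > 0"
  shows "percolation_prob (ladder G) (v0, 0) p > 0"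
proof -
  interpret bounded_graph "verts G" "traversable G" D by (rule G)
  let ?V = "verts G" and ?I = "verts G \<times> (UNIV :: nat set)"
  let ?X = "explored {v0} (\<lambda>_. 0) {v0}"
  have fresh: "fresh {v0} (\<lambda>_. 0) {v0} = ?I - {(v0, 0)}"
    using v0 by (auto simp: fresh_def)
  have "0 < Pr ?V q (\<lambda>\<omega>. reaches_infinity G \<omega> v0)"
    using pos by (simp add: percolation_prob_eq)
  also have "\<dots> \<le> Pr ?V q (\<lambda>\<omega>. infinite (reach (traversable G) (?V - {v0}) {v0} \<omega>))"
    using finite_T v0 by (intro Pr_mono determined_inf_reach) (auto simp: reaches_infinity_iff)
  also have "\<dots> \<le> Pr ?I p (\<lambda>\<omega>. infinite (?X \<omega>))"
    unfolding explored_def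
  proof (rule Pr_infinite_reach[OF countable_fresh])
    show "Pr ?V q (\<lambda>\<omega>. infinite (reach (traversable G) (?V - {v0}) {v0} \<omega>)) \<le>
        Pr ?I p (\<lambda>\<omega>. at_least k (reach ladder_step (fresh {v0} (\<lambda>_. 0) {v0}) ((\<lambda>a. (a, 0)) ` {v0}) \<omega>))" for k
      using Pr_infinite_reach_le_explored[OF p pq, of "{v0}" "{v0}" k "\<lambda>_. 0"] v0
      by (simp add: explored_def)
  qed (simp_all add: fresh)
  finally have "0 < p * Pr ?I p (\<lambda>\<omega>. infinite (?X \<omega>))"
    using p by simp
  also have "\<dots> = Pr ?I p (\<lambda>\<omega>. \<omega> (v0, 0)) * Pr ?I p (\<lambda>\<omega>. infinite (?X \<omega>))"
    using Pr_ball[of "{(v0, 0)}" ?I p "\<lambda>_. True"] p v0 by simp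
  also have "\<dots> = Pr ?I p (\<lambda>\<omega>. \<omega> (v0, 0) \<and> infinite (?X \<omega>))"
  proof (rule Pr_conj_indep[symmetric])
    show "determined {(v0, 0)} (\<lambda>\<omega>. \<omega> (v0, 0))" by (simp add: determined_coord)
    show "determined (?I - {(v0, 0)}) (\<lambda>\<omega>. infinite (?X \<omega>))"
      unfolding explored_def by (intro determined_infinite_reach countable_fresh) (simp_all add: fresh)
  qed (use v0 in simp)
  also have "\<dots> = percolation_prob (ladder G) (v0, 0) p"
    unfolding percolation_prob_eq verts_ladder
    by (subst reaches_infinity_iff)
      (simp_all add: traversable_ladder[OF G] finite_ladder_step verts_ladder v0 explored_def fresh)
  finally show ?thesis .
qed

section \<open>Strict inequality of the critical values\<close>

lemma site_pc_lower:
  assumes "\<And>p. 0 \<le> p \<Longrightarrow> p < c \<Longrightarrow> percolation_prob G v0 p = 0" "c \<le> 1"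
  shows "c \<le> site_pc G v0"
  unfolding site_pc_def
proof (rule cInf_greatest)
  fix p assume "p \<in> insert 1 {p. 0 \<le> p \<and> p \<le> 1 \<and> 0 < percolation_prob G v0 p}"
  then show "c \<le> p" using assms(1)[of p] assms(2) by (cases "p < c") auto
qed simp

lemma site_pc_upper:
  assumes "0 \<le> p" "p \<le> 1" "percolation_prob G v0 p > 0"
  shows "site_pc G v0 \<le> p"
  unfolding site_pc_def
proof (rule cInf_lower)
  show "bdd_below (insert 1 {p. 0 \<le> p \<and> p \<le> 1 \<and> 0 < percolation_prob G v0 p})"
    by (intro bdd_belowI[of _ 0]) auto
qed (use assms in simp)

theorem theorem5:
  fixes G :: "'a mixed_graph" and v0 :: 'a
  assumes "oriented_graph G \<or> unoriented_graph G"
    and "connected_graph G"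
    and "bounded_degree G"
    and "v0 \<in> verts G"
    and "site_pc G v0 < 1"
  shows "site_pc (ladder G) (v0, 0) < site_pc G v0"
proof -
  obtain D where D: "D > 0" and G: "bounded_graph (verts G) (traversable G) D"
    using assms(1-4) by (rule bounded_graphI)
  interpret bounded_graph "verts G" "traversable G" D by (rule G)
  define c where "c = site_pc G v0"
  \<comment> \<open>Below \<open>1 / D\<close> the path count excludes percolation. Thus
    \<open>c\<close> is positive and there is room for a parameter \<open>p\<close> below
    it.\<close>
  have "1 / D \<le> c"
    unfolding c_def
  proof (rule site_pc_lower)
    fix p :: real assume p: "0 \<le> p" "p < 1 / D"
    have "1 / D \<le> 1" using D by simp
    then have p1: "p \<le> 1" using p(2) by linarith
    have Dp: "D * p < 1" using p D by (simp add: field_simps)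
    have "percolation_prob G v0 p \<le> Pr (verts G) p (\<lambda>\<omega>. infinite (reach (traversable G) (verts G - {v0}) {v0} \<omega>))"
      unfolding percolation_prob_eq
      using finite_T assms(4) by (intro Pr_mono determined_inf_reach) (auto simp: reaches_infinity_iff)
    also have "\<dots> = 0"
      using p(1) p1 Dp by (rule Pr_infinite_reach_eq_0)
    finally show "percolation_prob G v0 p = 0"
      by (simp add: percolation_prob_def measure_le_0_iff)
  qed (use D in simp)
  with D have c: "0 < c" "c < 1"
    using assms(5) by (auto simp: c_def intro: less_le_trans[of 0 "1 / D"])
  \<comment> \<open>With \<open>p = c - e\<close> and \<open>q < c + e\<close>, the three bounds
    give \<open>c / 2 \<le> p\<close>, \<open>q < 1\<close>, and
    \<open>D * (q - p) \<le> (1 - c) * (c / 2) ^ Suc D\<close>, which is at most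
    \<open>(1 - p) * p ^ Suc D\<close>.\<close>
  define e where "e = Min {c / 2, (1 - c) / 2, (1 - c) * (c / 2) ^ Suc D / (2 * D)}"
  have e: "e \<le> c / 2" "e \<le> (1 - c) / 2" "e \<le> (1 - c) * (c / 2) ^ Suc D / (2 * D)"
    unfolding e_def by (rule Min_le; simp)+
  have "0 < e" using c D by (simp add: e_def)
  have "Inf (insert 1 {p. 0 \<le> p \<and> p \<le> 1 \<and> 0 < percolation_prob G v0 p}) < c + e"
    using \<open>0 < e\<close> by (simp add: c_def site_pc_def)
  then obtain q where q: "q = 1 \<or> 0 \<le> q \<and> q \<le> 1 \<and> 0 < percolation_prob G v0 q" "q < c + e"
    using cInf_lessD[of "insert 1 {p. 0 \<le> p \<and> p \<le> 1 \<and> 0 < percolation_prob G v0 p}"] by auto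
  \<comment> \<open>This rules out the default value 1 inserted into the infimum, so percolation
    does occur at \<open>q\<close>.\<close>
  have "q < 1" using q(2) e(2) c by argo
  with q(1) have q': "0 \<le> q" "q \<le> 1" "0 < percolation_prob G v0 q" by auto
  then have "c \<le> q" unfolding c_def by (rule site_pc_upper)
  define p where "p = c - e"
  have p: "c / 2 \<le> p" "0 < p" "p < c" "p < q"
    using \<open>0 < e\<close> e(1) c \<open>c \<le> q\<close> by (auto simp: p_def)
  have "D * (q - p) \<le> D * (2 * e)"
    using q(2) by (intro mult_left_mono) (auto simp: p_def)
  also have "\<dots> \<le> (1 - c) * (c / 2) ^ Suc D"
    using e(3) D by (simp add: field_simps)
  also have "\<dots> \<le> (1 - p) * p ^ Suc D"
    using c p by (intro mult_mono power_mono) auto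
  finally have "percolation_prob (ladder G) (v0, 0) p > 0"
    using percolation_prob_ladder_pos[OF G assms(4) p(2,4) q'(2) _ q'(3)] by blast
  then have "site_pc (ladder G) (v0, 0) \<le> p"
    using p c by (intro site_pc_upper) auto
  then show ?thesis using p(3) by (simp add: c_def)
qed

end
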